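(* Suppose the sale vector $\mathbf x=(x_1,\dots,x_n)$ belongs to the pooled feasible set $$\widehat{\mathcal F}^{\mathrm{pool}}_{u,\Delta}=\Big\{\mathbf x:\ \sum_iK_i+\underline{\mathcal B}_{u,\Delta}\Big(\sum_ix_i\Big)\ \ge\ \sum_i\overline H_i+M^{\mathrm{agg}}_u\Big\},$$ the realized path lies in the registered aggregate operating set $\mathcal U^{\mathrm{op}}_{u,\mathrm{agg}}(\Delta)$, the shared execution settles by the horizon $u+\Delta$, and the bucket waterfall may legally pool cash across the included loans. Then all bucket debt can be extinguished and at least $M^{\mathrm{agg}}_u$ remains.
   Context: Consider $n$ leveraged positions in the same token (a risk bucket) that share one execution book in the same window starting at decision time $u$ with horizon $\Delta$. Position $i$ has token quantity $q_i$, sale quantity $x_i\in[0,q_i]$, dedicated confirmed cash $K_i\ge0$, and $\overline H_i$ is an upper bound, over the aggregate operating set, on its debt-service requirement, i.e. on the cash applied to its loan after $u$ plus the debt outstanding at $u+\Delta$ (the total cash needed to extinguish loan $i$ by $u+\Delta$). $\mathcal U^{\mathrm{op}}_{u,\mathrm{agg}}(\Delta)\subseteq\Omega$ is a set of paths. $\mathcal B^{\mathrm{set},\Pi}_{u,\Delta}(X,\omega)$ is the settled (confirmed by $u+\Delta$) net proceeds on path $\omega$ from executing aggregate quantity $X$ through the shared book under policy $\Pi$, and $$\underline{\mathcal B}_{u,\Delta}(X)=\inf_{\omega\in\mathcal U^{\mathrm{op}}_{u,\mathrm{agg}}(\Delta)}\mathcal B^{\mathrm{set},\Pi}_{u,\Delta}(X,\omega).$$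 $M^{\mathrm{agg}}_u\ge0$ is a shared buffer. Pooling means that all confirmed cash of the bucket (all $K_i$ and the aggregate settled proceeds) may be applied to every included loan. *)

theory Defs
  imports "HOL-Analysis.Analysis"
begin

text \<open>
  Positions are indexed by a finite type \<open>'i\<close>, so \<open>n = CARD('i)\<close>; paths are the elements of \<open>'w\<close>,
  which plays the role of \<open>\<Omega>\<close>. Under the fixed policy, \<open>book X \<omega> t\<close> is the cumulative net cash from
  executing the aggregate quantity \<open>X\<close> through the shared book on path \<open>\<omega>\<close> that is confirmed by
  time \<open>t\<close>. It may be negative, since it is net of execution costs.
\<close>

definition settled_proceeds ::
  "(real \<Rightarrow> 'w \<Rightarrow> real \<Rightarrow> real) \<Rightarrow> real \<Rightarrow> real \<Rightarrow> real \<Rightarrow> 'w \<Rightarrow> real"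
  where "settled_proceeds book u \<Delta> X \<omega> = book X \<omega> (u + \<Delta>)"

text \<open>Nothing is left to be confirmed, and nothing is reversed, after time \<open>T\<close>.\<close>

definition settles_by :: "(real \<Rightarrow> 'w \<Rightarrow> real \<Rightarrow> real) \<Rightarrow> real \<Rightarrow> 'w \<Rightarrow> real \<Rightarrow> bool"
  where "settles_by book X \<omega> T \<longleftrightarrow> (\<forall>t\<ge>T. book X \<omega> t = book X \<omega> T)"

text \<open>
  The infimum is taken in \<^typ>\<open>ereal\<close>: if the proceeds are unbounded below on \<open>U\<close> it is \<open>-\<infinity>\<close>, and no
  sale vector with that aggregate quantity is feasible.
\<close>

definition worst_proceeds ::
  "(real \<Rightarrow> 'w \<Rightarrow> real \<Rightarrow> real) \<Rightarrow> 'w set \<Rightarrow> real \<Rightarrow> real \<Rightarrow> real \<Rightarrow> ereal"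
  where "worst_proceeds book U u \<Delta> X = (INF \<omega>\<in>U. ereal (settled_proceeds book u \<Delta> X \<omega>))"

definition pooled_feasible ::
  "(real \<Rightarrow> 'w \<Rightarrow> real \<Rightarrow> real) \<Rightarrow> 'w set \<Rightarrow> real \<Rightarrow> real \<Rightarrow>
   ('i::finite \<Rightarrow> real) \<Rightarrow> ('i \<Rightarrow> real) \<Rightarrow> real \<Rightarrow> ('i \<Rightarrow> real) set"
  where "pooled_feasible book U u \<Delta> K Hbar M =
    {x. ereal (\<Sum>i\<in>UNIV. K i) + worst_proceeds book U u \<Delta> (\<Sum>i\<in>UNIV. x i)
          \<ge> ereal ((\<Sum>i\<in>UNIV. Hbar i) + M)}"

text \<open>
  \<open>applied i \<omega>\<close> is the cash applied to loan \<open>i\<close> after \<open>u\<close> (up to \<open>u + \<Delta>\<close>) and \<open>outstanding i \<omega>\<close> is the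
  debt of loan \<open>i\<close> still outstanding at \<open>u + \<Delta>\<close>.
\<close>

definition debt_service :: "('i \<Rightarrow> 'w \<Rightarrow> real) \<Rightarrow> ('i \<Rightarrow> 'w \<Rightarrow> real) \<Rightarrow> 'i \<Rightarrow> 'w \<Rightarrow> real"
  where "debt_service applied outstanding i \<omega> = applied i \<omega> + outstanding i \<omega>"

text \<open>
  A waterfall maps the confirmed cash of the bucket (the dedicated cash \<open>K\<close> of each position and the
  settled proceeds \<open>b\<close>) to the set of legally permitted vectors of payments to the loans. It may pool
  if the whole of that cash may be applied to the loans in any proportion, whichever position
  the cash came from.
\<close>

definition may_pool :: "(('i::finite \<Rightarrow> real) \<Rightarrow> real \<Rightarrow> ('i \<Rightarrow> real) set) \<Rightarrow> bool"
  where "may_pool waterfall \<longleftrightarrow>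
    (\<forall>K b p. (\<forall>i. 0 \<le> K i) \<longrightarrow> (\<forall>i. 0 \<le> p i) \<longrightarrow>
       (\<Sum>i\<in>UNIV. p i) \<le> (\<Sum>i\<in>UNIV. K i) + b \<longrightarrow> p \<in> waterfall K b)"

text \<open>
  With final payments \<open>y\<close> at \<open>u + \<Delta>\<close>, the bucket pays \<open>applied i \<omega> + y i\<close> to loan \<open>i\<close> over the window.
  These payments must be permitted, clear every outstanding debt, and leave at least \<open>M\<close> of the
  confirmed cash.
\<close>

definition can_extinguish_leaving ::
  "(('i::finite \<Rightarrow> real) \<Rightarrow> real \<Rightarrow> ('i \<Rightarrow> real) set) \<Rightarrow> ('i \<Rightarrow> real) \<Rightarrow> real \<Rightarrow>
   ('i \<Rightarrow> 'w \<Rightarrow> real) \<Rightarrow> ('i \<Rightarrow> 'w \<Rightarrow> real) \<Rightarrow> 'w \<Rightarrow> real \<Rightarrow> bool"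
  where "can_extinguish_leaving waterfall K b applied outstanding \<omega> M \<longleftrightarrow>
    (\<exists>y. (\<forall>i. 0 \<le> y i) \<and>
         (\<lambda>i. applied i \<omega> + y i) \<in> waterfall K b \<and>
         (\<forall>i. outstanding i \<omega> - y i = 0) \<and>
         (\<Sum>i\<in>UNIV. K i) + b - (\<Sum>i\<in>UNIV. applied i \<omega> + y i) \<ge> M)"

end

theory Submission
  imports Defs
begin

text \<open>Pay each loan its full debt service on the realized path. Since that path lies in
  \<open>U\<close>, the infimum in the feasibility condition bounds the realized proceeds from
  below, and each debt service is at most \<open>Hbar i\<close>. Summing over the bucket, the
  confirmed cash covers all payments plus \<open>M\<close>. Pooling makes this one aggregate
  inequality sufficient: a deficit at one position may be met by a surplus at another.\<close>

theorem theorem8p2: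
  fixes book :: "real \<Rightarrow> 'w \<Rightarrow> real \<Rightarrow> real"
    and U :: "'w set" and u \<Delta> M :: real
    and q x K Hbar :: "'i::finite \<Rightarrow> real"
    and applied outstanding :: "'i \<Rightarrow> 'w \<Rightarrow> real"
    and waterfall :: "('i \<Rightarrow> real) \<Rightarrow> real \<Rightarrow> ('i \<Rightarrow> real) set"
    and \<omega> :: 'w
  assumes horizon: "0 \<le> \<Delta>"
    and sale: "\<And>i. x i \<in> {0..q i}"
    and cash: "\<And>i. 0 \<le> K i"
    and buffer: "0 \<le> M"
    and applied: "\<And>i \<omega>. \<omega> \<in> U \<Longrightarrow> 0 \<le> applied i \<omega>"
    and outstanding: "\<And>i \<omega>. \<omega> \<in> U \<Longrightarrow> 0 \<le> outstanding i \<omega>"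
    and Hbar: "\<And>i \<omega>. \<omega> \<in> U \<Longrightarrow> debt_service applied outstanding i \<omega> \<le> Hbar i"
    and feasible: "x \<in> pooled_feasible book U u \<Delta> K Hbar M"
    and realized: "\<omega> \<in> U"
    and settled: "settles_by book (\<Sum>i\<in>UNIV. x i) \<omega> (u + \<Delta>)"
    and pool: "may_pool waterfall"
  shows "can_extinguish_leaving waterfall K
           (settled_proceeds book u \<Delta> (\<Sum>i\<in>UNIV. x i) \<omega>) applied outstanding \<omega> M"
proof -
  define b where "b = settled_proceeds book u \<Delta> (\<Sum>i\<in>UNIV. x i) \<omega>"
  \<comment> \<open>Total payments over the window when the final payment to each loan equals its
    outstanding debt.\<close>
  define p where "p = (\<lambda>i. applied i \<omega> + outstanding i \<omega>)"
  have p_nonneg: "0 \<le> p i" for i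
    unfolding p_def using applied[OF realized] outstanding[OF realized] by simp
  have "worst_proceeds book U u \<Delta> (\<Sum>i\<in>UNIV. x i) \<le> ereal b"
    unfolding worst_proceeds_def b_def using realized by (rule INF_lower)
  then have "ereal (\<Sum>i\<in>UNIV. K i) + worst_proceeds book U u \<Delta> (\<Sum>i\<in>UNIV. x i)
      \<le> ereal (\<Sum>i\<in>UNIV. K i) + ereal b"
    by (rule add_left_mono)
  with feasible have "ereal ((\<Sum>i\<in>UNIV. Hbar i) + M) \<le> ereal (\<Sum>i\<in>UNIV. K i) + ereal b"
    unfolding pooled_feasible_def mem_Collect_eq by (rule order_trans)
  \<comment> \<open>The possibly infinite infimum has been replaced by the finite \<open>b\<close>,
    so the inequality descends from \<open>ereal\<close> to \<open>real\<close>.\<close>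
  then have cover: "(\<Sum>i\<in>UNIV. Hbar i) + M \<le> (\<Sum>i\<in>UNIV. K i) + b"
    by simp
  have "(\<Sum>i\<in>UNIV. p i) \<le> (\<Sum>i\<in>UNIV. Hbar i)"
    using Hbar[OF realized] unfolding debt_service_def p_def by (rule sum_mono)
  with cover have left: "(\<Sum>i\<in>UNIV. p i) + M \<le> (\<Sum>i\<in>UNIV. K i) + b"
    by simp
  \<comment> \<open>As \<open>M\<close> is nonnegative, the payments fit within the cash, which is
    the budget condition in \<open>may_pool\<close>.\<close>
  with buffer have "(\<Sum>i\<in>UNIV. p i) \<le> (\<Sum>i\<in>UNIV. K i) + b"
    by simp
  with pool cash p_nonneg have "p \<in> waterfall K b"
    unfolding may_pool_def by blast
  with left outstanding[OF realized] show ?thesis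
    unfolding can_extinguish_leaving_def b_def[symmetric] p_def
    by (intro exI[of _ "\<lambda>i. outstanding i \<omega>"]) simp
qed

end
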